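(* Let $\vdash$ be a regular entailment relation for an ordered group $G$, let $x\in G$, and for $y\in G$ define the relation $\vdash_y$ on $\mathrm{P}_{\mathrm{fe}}^*(G)$ by $A\vdash_y B$ iff there is an integer $p\ge0$ such that $A,A+py\vdash B$. If $A\vdash_x B$ and $A\vdash_{-x}B$, then $A\vdash B$.
   Context: Groups are commutative; an ordered group is a commutative group with a partial order $\le_G$ compatible with addition. $\mathrm{P}_{\mathrm{fe}}^*(G)$ is the set of nonempty finite subsets of $G$; $a$ stands for $\{a\}$, $A,A'$ for $A\cup A'$, $x+A=\{x+a:a\in A\}$. An unbounded entailment relation on $G$ is a relation $\vdash$ on $\mathrm{P}_{\mathrm{fe}}^*(G)$ with: $a\vdash a$; $A\vdash B\Rightarrow A,A'\vdash B,B'$; ($A\vdash B,c$ and $A,c\vdash B$) $\Rightarrow A\vdash B$. It is regular if moreover $a\le_G b\Rightarrow a\vdash b$; $A\vdash B\Rightarrow x+A\vdash x+B$ for all $x\in G$; and $x+a,y+b\vdash y+a,x+b$ for all $a,b,x,y\in G$. *)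

theory Defs
  imports Main
begin

definition Pfe :: "'a set set" where
  "Pfe = {A. finite A \<and> A \<noteq> {}}"

(* A relation on Pfe is represented by a predicate on all sets; its values on pairs
   outside Pfe are unconstrained and irrelevant. *)
locale unbounded_entailment =
  fixes ent :: "'a set \<Rightarrow> 'a set \<Rightarrow> bool"  (infix "\<turnstile>" 50)
  assumes refl: "{a} \<turnstile> {a}"
    and mono: "\<lbrakk>A \<in> Pfe; A' \<in> Pfe; B \<in> Pfe; B' \<in> Pfe; A \<turnstile> B\<rbrakk> \<Longrightarrow> A \<union> A' \<turnstile> B \<union> B'"
    and cut: "\<lbrakk>A \<in> Pfe; B \<in> Pfe; A \<turnstile> B \<union> {c}; A \<union> {c} \<turnstile> B\<rbrakk> \<Longrightarrow> A \<turnstile> B"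

(* The class ordered_ab_group_add only asks for a partial order compatible with addition. *)
locale regular_entailment = unbounded_entailment ent
  for ent :: "'a::ordered_ab_group_add set \<Rightarrow> 'a set \<Rightarrow> bool"  (infix "\<turnstile>" 50) +
  assumes order: "a \<le> b \<Longrightarrow> {a} \<turnstile> {b}"
    and translate: "\<lbrakk>A \<in> Pfe; B \<in> Pfe; A \<turnstile> B\<rbrakk> \<Longrightarrow> (+) x ` A \<turnstile> (+) x ` B"
    and regular: "{x + a, y + b} \<turnstile> {y + a, x + b}"

primrec nat_mult :: "nat \<Rightarrow> 'a::monoid_add \<Rightarrow> 'a" where
  "nat_mult 0 y = 0"
| "nat_mult (Suc p) y = y + nat_mult p y"

definition ent_adjoin ::
  "('a::ab_group_add set \<Rightarrow> 'a set \<Rightarrow> bool) \<Rightarrow> 'a \<Rightarrow> 'a set \<Rightarrow> 'a set \<Rightarrow> bool" where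
  "ent_adjoin ent y A B \<longleftrightarrow> (\<exists>p. ent (A \<union> (\<lambda>a. a + nat_mult p y) ` A) B)"

end

theory Submission
  imports Defs
begin

text \<open>
  If \<open>A \<turnstile> B\<close> fails, then cut lets us enlarge \<open>A\<close> and \<open>B\<close> to finite sets \<open>C\<close> and \<open>D\<close> which
  still satisfy \<open>\<not> C \<turnstile> D\<close> and whose union contains every relevant translate \<open>a + k x\<close> and
  \<open>a - k x\<close>. By regularity, translation by \<open>x\<close> cannot lead both from \<open>C\<close> into \<open>D\<close> and from
  \<open>D\<close> into \<open>C\<close>. Hence \<open>C\<close> is closed, within these translates, under adding \<open>x\<close> or under
  subtracting \<open>x\<close>; in the first case \<open>A\<close> and \<open>A + p x\<close> are contained in \<open>C\<close>, so that
  \<open>A, A + p x \<turnstile> B\<close> yields \<open>C \<turnstile> D\<close>, a contradiction, and the second case is symmetric.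
\<close>

context unbounded_entailment
begin

lemma mono_subset:
  assumes "A \<turnstile> B" "A \<in> Pfe" "B \<in> Pfe" "A \<subseteq> C" "B \<subseteq> D" "finite C" "finite D"
  shows "C \<turnstile> D"
proof -
  have "C \<in> Pfe" "D \<in> Pfe"
    using assms by (auto simp: Pfe_def)
  then have "A \<union> C \<turnstile> B \<union> D"
    using mono assms by blast
  with assms show ?thesis
    by (simp add: Un_absorb1)
qed

text \<open>By the contrapositive of \<open>cut\<close>, each element of \<open>X\<close> in turn
  can join one of the two sides without creating an entailment.\<close>

lemma extend_non_entailment:
  assumes "finite X" "A \<in> Pfe" "B \<in> Pfe" "\<not> A \<turnstile> B"
  obtains C D where "finite C" "finite D" "A \<subseteq> C" "B \<subseteq> D" "X \<subseteq> C \<union> D" "\<not> C \<turnstile> D"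
proof -
  have "\<exists>C D. finite C \<and> finite D \<and> A \<subseteq> C \<and> B \<subseteq> D \<and> X \<subseteq> C \<union> D \<and> \<not> C \<turnstile> D"
    using assms(1)
  proof (induction X)
    case empty
    with assms show ?case
      by (auto simp: Pfe_def)
  next
    case (insert c X)
    then obtain C D where CD: "finite C" "finite D" "A \<subseteq> C" "B \<subseteq> D" "X \<subseteq> C \<union> D" "\<not> C \<turnstile> D"
      by blast
    then have "C \<in> Pfe" "D \<in> Pfe"
      using assms by (auto simp: Pfe_def)
    with CD(6) consider "\<not> C \<turnstile> D \<union> {c}" | "\<not> C \<union> {c} \<turnstile> D"
      using cut by blast
    then show ?case
    proof cases
      case 1
      with CD show ?thesis
        by (intro exI[of _ C] exI[of _ "D \<union> {c}"]) auto
    next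
      case 2
      with CD show ?thesis
        by (intro exI[of _ "C \<union> {c}"] exI[of _ D]) auto
    qed
  qed
  with that show ?thesis
    by blast
qed

end

text \<open>Induction on \<open>k\<close> keeps \<open>a + nat_mult k y\<close> in \<open>C\<close>,
  since \<open>closed\<close> excludes \<open>D\<close>. The shift \<open>y\<close> is arbitrary so
  as to cover both \<open>x\<close> and \<open>- x\<close>.\<close>

lemma entails_if_closed_under_shift:
  fixes y :: "'a::ab_group_add"
  assumes "unbounded_entailment ent"
    and "A \<in> Pfe" "B \<in> Pfe" "A \<subseteq> C" "B \<subseteq> D" "finite C" "finite D"
    and base: "ent (A \<union> (\<lambda>a. a + nat_mult p y) ` A) B"
    and orbit: "\<And>a k. a \<in> A \<Longrightarrow> k \<le> p \<Longrightarrow> a + nat_mult k y \<in> C \<union> D"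
    and closed: "\<And>c. c \<in> C \<Longrightarrow> c + y \<notin> D"
  shows "ent C D"
proof -
  interpret unbounded_entailment ent by fact
  have "a + nat_mult k y \<in> C" if "a \<in> A" "k \<le> p" for a k
    using that(2)
  proof (induction k)
    case 0
    with that(1) assms(4) show ?case
      by auto
  next
    case (Suc k)
    then have "a + nat_mult k y + y \<notin> D"
      using closed by simp
    with orbit[OF that(1) Suc.prems] show ?case
      by (simp add: ac_simps)
  qed
  then have "A \<union> (\<lambda>a. a + nat_mult p y) ` A \<subseteq> C"
    using assms(4) by auto
  moreover have "A \<union> (\<lambda>a. a + nat_mult p y) ` A \<in> Pfe"
    using assms(2) by (auto simp: Pfe_def)
  ultimately show ?thesis
    using mono_subset base assms(3,5-7) by blast
qed

theorem theorem2p11: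
  fixes ent :: "'a::ordered_ab_group_add set \<Rightarrow> 'a set \<Rightarrow> bool"
    and x :: 'a and A B :: "'a set"
  assumes "regular_entailment ent"
    and "A \<in> Pfe" and "B \<in> Pfe"
    and "ent_adjoin ent x A B"
    and "ent_adjoin ent (- x) A B"
  shows "ent A B"
proof (rule ccontr)
  interpret regular_entailment ent by fact
  assume not_ent: "\<not> ent A B"
  obtain p q where p: "ent (A \<union> (\<lambda>a. a + nat_mult p x) ` A) B"
    and q: "ent (A \<union> (\<lambda>a. a + nat_mult q (- x)) ` A) B"
    using assms(4,5) by (auto simp: ent_adjoin_def)
  define X where "X = (\<lambda>(a, k). a + nat_mult k x) ` (A \<times> {..p})
    \<union> (\<lambda>(a, k). a + nat_mult k (- x)) ` (A \<times> {..q})"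
  have "finite X"
    using assms(2) by (simp add: X_def Pfe_def)
  then obtain C D where CD: "finite C" "finite D" "A \<subseteq> C" "B \<subseteq> D" "X \<subseteq> C \<union> D" "\<not> ent C D"
    using extend_non_entailment assms(2,3) not_ent by metis
  have "\<exists>c\<in>C. c + x \<in> D"
    using entails_if_closed_under_shift[OF unbounded_entailment_axioms assms(2,3) CD(3,4,1,2) p] CD(5,6)
    by (force simp: X_def)
  then obtain c where c: "c \<in> C" "c + x \<in> D"
    by blast
  have "\<exists>d\<in>C. d + - x \<in> D"
    using entails_if_closed_under_shift[OF unbounded_entailment_axioms assms(2,3) CD(3,4,1,2) q] CD(5,6)
    by (force simp: X_def)
  then obtain d where d: "d \<in> C" "d + - x \<in> D"
    by blast
  \<comment> \<open>Regularity for the shifts \<open>0\<close> and \<open>x\<close> of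
    \<open>c\<close> and \<open>d - x\<close>: the left side lies in \<open>C\<close>, the right
    side in \<open>D\<close>.\<close>
  have "ent {0 + c, x + (d - x)} {x + c, 0 + (d - x)}"
    by (rule regular)
  then have "ent {c, d} {c + x, d + - x}"
    by (simp add: ac_simps)
  then have "ent C D"
    by (rule mono_subset) (use c d CD(1,2) in \<open>auto simp: Pfe_def\<close>)
  with CD(6) show False
    by contradiction
qed

end
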